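(* Let $X$ be a Banach space and let $\mathcal{T}=\{T_t\}_{t\in\Delta}$ be a $C_0$-semigroup on $X$ indexed by a complex sector $\Delta$. Then the following assertions are equivalent: (1) $\mathcal{T}$ is distributionally sensitive; (2) $\mathcal{T}$ admits a distributionally unbounded vector; (3) the set $\mathrm{DUnbd}(\mathcal{T})$ of all distributionally unbounded vectors is a dense $G_\delta$ subset of $X$.
   Context: A complex sector is $\Delta=\Delta(\alpha)=\{re^{i\theta}\in\mathbb{C}: r\ge 0,\ |\theta|\le\alpha\}$ for some $\alpha\in(0,\pi/2)$; it is a semigroup under addition. For $r>0$ put $\Delta_r=\{t\in\Delta:|t|<r\}$. With $\mu$ the (planar) Lebesgue measure, the upper density of a measurable $A\subset\Delta$ is $\overline{\mathrm{dens}}(A)=\limsup_{r\to\infty}\mu(A\cap\Delta_r)/\mu(\Delta_r)$. A family $\{T_t\}_{t\in\Delta}$ of continuous linear operators on a Banach space $X$ is a $C_0$-semigroup if $T_0=I$, $T_tT_s=T_{t+s}$ for all $t,s\in\Delta$, and $\lim_{t\to s}T_tx=T_sx$ in norm for all $s\in\Delta$, $x\in X$. $\mathcal{T}$ is distributionally sensitive if there is $\delta>0$ such that for every $x\in X$ and $\varepsilon>0$ there is $y\in X$ with $\|x-y\|<\varepsilon$ and $\overline{\mathrm{dens}}(\{t\in\Delta:\|T_tx-T_ty\|>\delta\})=1$. A vector $x\in X$ is distributionally unbounded if there is a measurable $A\subset\Delta$ with $\overline{\mathrm{dens}}(A)=1$ such that $\lim_{t\in A,\,|t|\to\infty}\|T_tx\|=\infty$.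 *)

theory Defs
  imports "HOL-Analysis.Analysis"
begin

definition sector :: "real \<Rightarrow> complex set" where
  "sector \<alpha> = {rcis r \<theta> | r \<theta>. 0 \<le> r \<and> \<bar>\<theta>\<bar> \<le> \<alpha>}"

definition truncated_sector :: "real \<Rightarrow> real \<Rightarrow> complex set" where
  "truncated_sector \<alpha> r = {t \<in> sector \<alpha>. norm t < r}"

text \<open>The limsup is taken in the extended reals, since \<^const>\<open>Limsup\<close> requires a complete lattice.\<close>

definition upper_density :: "real \<Rightarrow> complex set \<Rightarrow> ereal" where
  "upper_density \<alpha> A =
     Limsup at_top (\<lambda>r::real.
       ereal (measure lebesgue (A \<inter> truncated_sector \<alpha> r) / measure lebesgue (truncated_sector \<alpha> r)))"

text \<open>Operator families are total functions on \<^typ>\<open>complex\<close> of which only the values on the sector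
  matter. The class \<^class>\<open>banach\<close> consists of real Banach spaces; a complex Banach space is
  covered through its underlying real space, as complex-linear operators are real-linear and the
  notions below involve only the addition, the norm and the topology.\<close>

definition C0_semigroup :: "real \<Rightarrow> (complex \<Rightarrow> 'a::banach \<Rightarrow> 'a) \<Rightarrow> bool" where
  "C0_semigroup \<alpha> T \<longleftrightarrow>
     (\<forall>t\<in>sector \<alpha>. bounded_linear (T t)) \<and>
     T 0 = id \<and>
     (\<forall>t\<in>sector \<alpha>. \<forall>s\<in>sector \<alpha>. T t \<circ> T s = T (t + s)) \<and>
     (\<forall>s\<in>sector \<alpha>. \<forall>x. ((\<lambda>t. T t x) \<longlongrightarrow> T s x) (at s within sector \<alpha>))"

definition distributionally_sensitive :: "real \<Rightarrow> (complex \<Rightarrow> 'a::banach \<Rightarrow> 'a) \<Rightarrow> bool" where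
  "distributionally_sensitive \<alpha> T \<longleftrightarrow>
     (\<exists>\<delta>>0. \<forall>x. \<forall>\<epsilon>>0. \<exists>y. norm (x - y) < \<epsilon> \<and>
        upper_density \<alpha> {t \<in> sector \<alpha>. norm (T t x - T t y) > \<delta>} = 1)"

text \<open>The filter \<^term>\<open>inf at_infinity (principal A)\<close> expresses that \<open>t\<close> stays in \<open>A\<close> while its
  modulus tends to infinity.\<close>

definition distributionally_unbounded :: "real \<Rightarrow> (complex \<Rightarrow> 'a::banach \<Rightarrow> 'a) \<Rightarrow> 'a \<Rightarrow> bool" where
  "distributionally_unbounded \<alpha> T x \<longleftrightarrow>
     (\<exists>A\<in>sets lebesgue. A \<subseteq> sector \<alpha> \<and> upper_density \<alpha> A = 1 \<and>
        filterlim (\<lambda>t. norm (T t x)) at_top (inf at_infinity (principal A)))"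

definition DUnbd :: "real \<Rightarrow> (complex \<Rightarrow> 'a::banach \<Rightarrow> 'a) \<Rightarrow> 'a set" where
  "DUnbd \<alpha> T = {x. distributionally_unbounded \<alpha> T x}"

end

theory Submission
  imports Defs
begin

text \<open>A vector is distributionally unbounded iff each superlevel set of its orbit norm has upper
  density 1; the set witnessing unboundedness glues these superlevel sets together on sectorial
  annuli with rapidly growing radii. The area of a truncated superlevel set is lower semicontinuous
  in the vector, so the distributionally unbounded vectors form a \<open>G\<^sub>\<delta>\<close> set.
  Sensitivity yields, after scaling, arbitrarily small \<open>z\<close> with \<open>\<parallel>T t z\<parallel> > 2 * M\<close> on a set of
  density 1. Among the translates \<open>x + i *\<^sub>R z\<close> with \<open>i < n\<close> at most one has \<open>\<parallel>T t (x + i *\<^sub>R z)\<parallel> \<le> M\<close>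
  for each such \<open>t\<close>, so by averaging one of them has a superlevel set of relative area close to
  \<open>1 - 1 / n\<close>. Hence the open sets in question are dense and Baire's theorem applies.\<close>

section \<open>Geometry and area of the sector\<close>

text \<open>Cosine is strictly decreasing on [0, pi], so comparing angles amounts to comparing
  cosines. In the resulting inequality, closedness and invariance under positive scaling are visible
  at once.\<close>

lemma sector_eq_cone:
  assumes "0 < \<alpha>" "\<alpha> < pi"
  shows "sector \<alpha> = {t. norm t * cos \<alpha> \<le> Re t}"
proof (intro equalityI subsetI)
  fix t assume "t \<in> sector \<alpha>"
  then obtain r \<theta> where t: "t = rcis r \<theta>" "0 \<le> r" "\<bar>\<theta>\<bar> \<le> \<alpha>"
    unfolding sector_def by blast
  have "cos \<alpha> \<le> cos \<bar>\<theta>\<bar>"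
    using t(3) assms by (intro cos_monotone_0_pi_le) auto
  then show "t \<in> {t. norm t * cos \<alpha> \<le> Re t}"
    using t(1,2) by (simp add: mult_left_mono)
next
  fix t assume "t \<in> {t. norm t * cos \<alpha> \<le> Re t}"
  then have le: "norm t * cos \<alpha> \<le> norm t * cos (Arg t)"
    by (metis Re_rcis mem_Collect_eq rcis_cmod_Arg)
  show "t \<in> sector \<alpha>"
  proof (cases "t = 0")
    case True
    then have "t = rcis 0 0" by simp
    moreover have "\<bar>0::real\<bar> \<le> \<alpha>" using assms by simp
    ultimately show ?thesis unfolding sector_def by blast
  next
    case False
    then have "cos \<alpha> \<le> cos \<bar>Arg t\<bar>"
      using le by simp
    moreover have "\<bar>Arg t\<bar> \<le> pi"
      using Arg_bounded[of t] by auto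
    ultimately have "\<bar>Arg t\<bar> \<le> \<alpha>"
      using assms cos_monotone_0_pi[of \<alpha> "\<bar>Arg t\<bar>"] by fastforce
    moreover have "t = rcis (norm t) (Arg t)"
      by (simp add: rcis_cmod_Arg)
    ultimately show ?thesis
      unfolding sector_def by (metis (mono_tags, lifting) mem_Collect_eq norm_ge_zero)
  qed
qed

text \<open>A real-valued, division-free substitute for upper density 1. A radius \<open>r\<close>
  \<le> 0 is never a witness, since both areas then vanish.\<close>

definition full_upper_density :: "real \<Rightarrow> complex set \<Rightarrow> bool" where
  "full_upper_density \<alpha> A \<longleftrightarrow>
     (\<forall>c<1. \<forall>N. \<exists>r\<ge>N. c * measure lebesgue (truncated_sector \<alpha> r)
                         < measure lebesgue (A \<inter> truncated_sector \<alpha> r))"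

locale planar_sector =
  fixes \<alpha> :: real
  assumes angle_pos: "0 < \<alpha>" and angle_less_pi: "\<alpha> < pi"
begin

abbreviation sector_area :: "real \<Rightarrow> real" where
  "sector_area r \<equiv> measure lebesgue (truncated_sector \<alpha> r)"

lemma closed_sector: "closed (sector \<alpha>)"
  unfolding sector_eq_cone[OF angle_pos angle_less_pi]
  by (intro closed_Collect_le continuous_intros)

lemma truncated_sector_eq: "truncated_sector \<alpha> r = sector \<alpha> \<inter> ball 0 r"
  by (auto simp: truncated_sector_def)

lemma sector_sets_borel [measurable]: "sector \<alpha> \<in> sets borel"
  using closed_sector by simp

lemma truncated_sector_lmeasurable: "truncated_sector \<alpha> r \<in> lmeasurable"
  unfolding truncated_sector_eq
  by (intro bounded_set_imp_lmeasurable) auto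

lemma truncated_sector_sets [measurable]: "truncated_sector \<alpha> r \<in> sets lebesgue"
  using truncated_sector_lmeasurable by blast

lemma Int_truncated_sector_lmeasurable:
  "A \<in> sets lebesgue \<Longrightarrow> A \<inter> truncated_sector \<alpha> r \<in> lmeasurable"
  using fmeasurable_Int_fmeasurable[OF truncated_sector_lmeasurable] by (simp add: Int_commute)

text \<open>The truncated sector is the dilate of the unit one by the factor \<open>r\<close>, and
  planar measure scales by the square of that factor.\<close>

lemma sector_area_eq:
  assumes "0 < r"
  shows "sector_area r = r\<^sup>2 * sector_area 1"
proof -
  have "truncated_sector \<alpha> r = (\<lambda>t. r *\<^sub>R t + 0) ` truncated_sector \<alpha> 1"
  proof (intro equalityI subsetI)
    fix t assume t: "t \<in> truncated_sector \<alpha> r"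
    have "(1 / r) *\<^sub>R t \<in> truncated_sector \<alpha> 1"
      using t assms by (auto simp: truncated_sector_def sector_eq_cone[OF angle_pos angle_less_pi] field_simps)
    moreover have "t = r *\<^sub>R ((1 / r) *\<^sub>R t) + 0"
      using assms by simp
    ultimately show "t \<in> (\<lambda>t. r *\<^sub>R t + 0) ` truncated_sector \<alpha> 1"
      by blast
  next
    fix t assume "t \<in> (\<lambda>t. r *\<^sub>R t + 0) ` truncated_sector \<alpha> 1"
    then show "t \<in> truncated_sector \<alpha> r"
      using assms by (auto simp: truncated_sector_def sector_eq_cone[OF angle_pos angle_less_pi])
  qed
  then show ?thesis
    using measure_lebesgue_affine[of r 0 "truncated_sector \<alpha> 1"] by simp
qed

lemma unit_sector_area_pos: "0 < sector_area 1"
proof -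
  \<comment> \<open>Strict inequalities give an open subset of the unit sector; 1/2 lies in it
    because cos \<alpha> < 1.\<close>
  let ?U = "{t. norm t * cos \<alpha> < Re t} \<inter> ball (0::complex) 1"
  have "open ?U"
    by (intro open_Int open_Collect_less continuous_intros open_ball)
  moreover have "complex_of_real (1/2) \<in> ?U"
    using cos_monotone_0_pi[of 0 \<alpha>] angle_pos angle_less_pi by simp
  ultimately have "\<not> negligible ?U"
    using open_not_negligible by blast
  moreover have "?U \<subseteq> truncated_sector \<alpha> 1"
    by (auto simp: truncated_sector_eq sector_eq_cone[OF angle_pos angle_less_pi])
  ultimately have "\<not> negligible (truncated_sector \<alpha> 1)"
    using negligible_subset by blast
  then show ?thesis
    using truncated_sector_lmeasurable
    by (simp add: negligible_iff_measure less_le)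
qed

lemma sector_area_pos: "0 < r \<Longrightarrow> 0 < sector_area r"
  using unit_sector_area_pos by (subst sector_area_eq) auto

text \<open>Allows bounded parts of a set to be ignored when its density is computed.\<close>

lemma sector_area_negligible:
  assumes "0 < \<epsilon>"
  obtains N where "0 < N" "\<And>r. N \<le> r \<Longrightarrow> sector_area R \<le> \<epsilon> * sector_area r"
proof
  \<comment> \<open>The lower bound 1 ensures \<open>r\<close> \<le> \<open>r\<close>^2, so that a
    linear bound on \<open>r\<close> suffices.\<close>
  define N where "N = max 1 (sector_area R / (\<epsilon> * sector_area 1))"
  show "0 < N" by (simp add: N_def)
  fix r assume "N \<le> r"
  then have r: "1 \<le> r" "sector_area R / (\<epsilon> * sector_area 1) \<le> r"
    by (auto simp: N_def)
  then have "sector_area R / (\<epsilon> * sector_area 1) \<le> r\<^sup>2"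
    by (simp add: power2_eq_square) (metis mult_le_cancel_right1 order_trans not_less zero_le_one)
  then have "sector_area R \<le> r\<^sup>2 * (\<epsilon> * sector_area 1)"
    using assms unit_sector_area_pos by (simp add: pos_divide_le_eq)
  also have "\<dots> = \<epsilon> * sector_area r"
    using sector_area_eq[of r] r by simp
  finally show "sector_area R \<le> \<epsilon> * sector_area r" .
qed

section \<open>Sets of upper density one\<close>

text \<open>Holds for arbitrary \<open>A\<close>, because \<open>measure\<close> is 0 on
  nonmeasurable sets.\<close>

lemma measure_Int_truncated_sector_le:
  "measure lebesgue (A \<inter> truncated_sector \<alpha> r) \<le> sector_area r"
proof (cases "A \<inter> truncated_sector \<alpha> r \<in> sets lebesgue")
  case True
  then show ?thesis
    using truncated_sector_lmeasurable by (intro measure_mono_fmeasurable) auto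
qed (simp add: measure_notin_sets)

text \<open>The area quotient never exceeds 1, so the limsup equals 1 as soon as no \<open>c\<close>
  < 1 is eventually an upper bound.\<close>

lemma upper_density_eq_1_iff: "upper_density \<alpha> A = 1 \<longleftrightarrow> full_upper_density \<alpha> A"
proof -
  define f where
    "f = (\<lambda>r. measure lebesgue (A \<inter> truncated_sector \<alpha> r) / sector_area r)"
  have f_le: "f r \<le> 1" for r
    using measure_Int_truncated_sector_le[of A r]
    by (auto simp: f_def divide_le_eq_1 less_le)
  have ud: "upper_density \<alpha> A = Limsup at_top (\<lambda>r. ereal (f r))"
    by (simp add: upper_density_def f_def)
  have le1: "upper_density \<alpha> A \<le> 1"
    unfolding ud by (intro Limsup_bounded) (simp add: f_le)
  have f_less: "c < f r \<longleftrightarrow> c * sector_area r < measure lebesgue (A \<inter> truncated_sector \<alpha> r)"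
    if "0 < r" for c r
    using sector_area_pos[OF that] by (simp add: f_def pos_less_divide_eq)
  show ?thesis
  proof
    assume 1: "upper_density \<alpha> A = 1"
    show "full_upper_density \<alpha> A"
      unfolding full_upper_density_def
    proof (intro allI impI)
      fix c N :: real assume "c < 1"
      have "\<not> (\<forall>\<^sub>F r in at_top. f r \<le> c)"
      proof
        assume "\<forall>\<^sub>F r in at_top. f r \<le> c"
        then have "upper_density \<alpha> A \<le> ereal c"
          unfolding ud by (intro Limsup_bounded) simp
        then show False
          using 1 \<open>c < 1\<close> by simp
      qed
      \<comment> \<open>Radii of at least 1 have positive sector area, so the quotient can be
        multiplied out.\<close>
      then obtain r where "max N 1 \<le> r" "c < f r"
        unfolding eventually_at_top_linorder by (metis not_le)
      then show "\<exists>r\<ge>N. c * sector_area r < measure lebesgue (A \<inter> truncated_sector \<alpha> r)"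
        using f_less[of r c] by auto
    qed
  next
    assume full: "full_upper_density \<alpha> A"
    show "upper_density \<alpha> A = 1"
    proof (rule ccontr)
      assume "upper_density \<alpha> A \<noteq> 1"
      then have "upper_density \<alpha> A < ereal 1"
        using le1 by (simp add: one_ereal_def)
      then obtain c where c: "upper_density \<alpha> A < ereal c" "ereal c < ereal 1"
        using ereal_dense2 by blast
      then have "\<forall>\<^sub>F r in at_top. ereal (f r) < ereal c"
        unfolding ud by (intro Limsup_lessD)
      then obtain N where N: "\<And>r. N \<le> r \<Longrightarrow> f r < c"
        unfolding eventually_at_top_linorder by auto
      obtain r where "r \<ge> max N 1" "c * sector_area r < measure lebesgue (A \<inter> truncated_sector \<alpha> r)"
        using full c(2) unfolding full_upper_density_def by (metis ereal_less_eq(3) not_le)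
      then show False
        using f_less[of r c] N[of r] by auto
    qed
  qed
qed

text \<open>Enlarging a set, even after discarding a bounded part, preserves full density: the
  discarded area is negligible against large sectors.\<close>

lemma full_upper_density_mono:
  assumes A: "full_upper_density \<alpha> A" and B: "B \<in> sets lebesgue"
    and sub: "A \<subseteq> B \<union> truncated_sector \<alpha> R"
  shows "full_upper_density \<alpha> B"
  unfolding full_upper_density_def
proof (intro allI impI)
  fix c N :: real assume c: "c < 1"
  then obtain N' where N': "\<And>r. N' \<le> r \<Longrightarrow> sector_area R \<le> ((1 - c) / 2) * sector_area r"
    using sector_area_negligible[of "(1 - c) / 2" R] by auto
  \<comment> \<open>The slack 1 - \<open>c\<close> is split in half: \<open>A\<close> is used at
    level (1 + \<open>c\<close>) / 2, and the bounded part costs at most (1 - \<open>c\<close>) /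
    2.\<close>
  have "(1 + c) / 2 < 1"
    using c by simp
  then obtain r where r: "max N N' \<le> r"
    "((1 + c) / 2) * sector_area r < measure lebesgue (A \<inter> truncated_sector \<alpha> r)"
    using A unfolding full_upper_density_def by blast
  have "measure lebesgue (A \<inter> truncated_sector \<alpha> r)
      \<le> measure lebesgue ((B \<inter> truncated_sector \<alpha> r) \<union> truncated_sector \<alpha> R)"
  proof (cases "A \<inter> truncated_sector \<alpha> r \<in> sets lebesgue")
    case True
    then show ?thesis
      using sub Int_truncated_sector_lmeasurable[OF B] truncated_sector_lmeasurable
      by (intro measure_mono_fmeasurable fmeasurable.Un) auto
  qed (simp add: measure_notin_sets)
  also have "\<dots> \<le> measure lebesgue (B \<inter> truncated_sector \<alpha> r) + sector_area R"
    using B by (intro measure_Un_le) auto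
  also have "\<dots> \<le> measure lebesgue (B \<inter> truncated_sector \<alpha> r) + ((1 - c) / 2) * sector_area r"
    using N' r(1) by simp
  finally have "c * sector_area r < measure lebesgue (B \<inter> truncated_sector \<alpha> r)"
    using r(2) by (simp add: field_simps)
  then show "\<exists>r\<ge>N. c * sector_area r < measure lebesgue (B \<inter> truncated_sector \<alpha> r)"
    using r(1) by auto
qed

text \<open>Radii are chosen recursively so that \<open>E n\<close> nearly fills the sector of the
  next radius, while the sector of the current one is negligible in it. Taking \<open>E n\<close> on
  the annulus between the two loses almost nothing.\<close>

lemma full_upper_density_diagonal:
  fixes E :: "nat \<Rightarrow> complex set"
  assumes E: "\<And>n. E n \<in> sets lebesgue" and full: "\<And>n. full_upper_density \<alpha> (E n)"
  obtains A where "A \<in> sets lebesgue" "A \<subseteq> sector \<alpha>" "full_upper_density \<alpha> A"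
    "\<And>n. \<exists>R. \<forall>t\<in>A. R \<le> norm t \<longrightarrow> (\<exists>m\<ge>n. t \<in> E m)"
proof -
  \<comment> \<open>\<open>P n r s\<close> makes \<open>s\<close> an admissible successor of the
    radius \<open>r\<close>; the increment of at least 1 drives the radii to infinity.\<close>
  define P where "P = (\<lambda>n r s. r + 1 \<le> s \<and> sector_area r \<le> (1 / real (n + 1)) * sector_area s \<and>
    (1 - 1 / real (n + 1)) * sector_area s < measure lebesgue (E n \<inter> truncated_sector \<alpha> s))"
  have "\<exists>s. P n r s" for n r
  proof -
    obtain N where N: "\<And>s. N \<le> s \<Longrightarrow> sector_area r \<le> (1 / real (n + 1)) * sector_area s"
      using sector_area_negligible[of "1 / real (n + 1)" r] by auto
    have "1 - 1 / real (n + 1) < 1"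
      by simp
    then obtain s where "max N (r + 1) \<le> s"
      "(1 - 1 / real (n + 1)) * sector_area s < measure lebesgue (E n \<inter> truncated_sector \<alpha> s)"
      using full[of n] unfolding full_upper_density_def by blast
    then show ?thesis
      using N unfolding P_def by auto
  qed
  \<comment> \<open>The choice predicate constrains only the initial radius; its sign is what starts
    the induction for \<open>r_ge\<close>.\<close>
  then obtain r :: "nat \<Rightarrow> real" where r0: "0 \<le> r 0" and P: "\<And>n. P n (r n) (r (Suc n))"
    using dependent_nat_choice[of "\<lambda>n x. n = 0 \<longrightarrow> 0 \<le> x" P] by (metis nat.distinct(1) order_refl)
  have step: "r n + 1 \<le> r (Suc n)" for n
    using P[of n] by (simp add: P_def)
  have r_ge: "real n \<le> r n" for n
  proof (induction n)
    case (Suc n)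
    then show ?case using step[of n] by simp
  qed (use r0 in simp)
  have mono: "mono r"
    unfolding mono_iff_le_Suc using step by (metis dual_order.trans le_add_same_cancel1 zero_le_one)
  define A where "A = (\<Union>n. E n \<inter> (truncated_sector \<alpha> (r (Suc n)) - truncated_sector \<alpha> (r n)))"
  have A: "A \<in> sets lebesgue"
    unfolding A_def using E by measurable
  show thesis
  proof
    show "A \<in> sets lebesgue" by fact
    show "A \<subseteq> sector \<alpha>"
      by (auto simp: A_def truncated_sector_def)
    show "full_upper_density \<alpha> A"
      unfolding full_upper_density_def
    proof (intro allI impI)
      fix c N :: real assume c: "c < 1"
      obtain n0 :: nat where n0: "2 / (1 - c) < real n0"
        using reals_Archimedean2 by blast
      obtain n1 :: nat where n1: "N < real n1"
        using reals_Archimedean2 by blast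
      define n where "n = max n0 n1"
      have n: "2 / (1 - c) < real (n + 1)" "N \<le> r (Suc n)"
        using n0 n1 r_ge[of "Suc n"] by (auto simp: n_def)
      define q where "q = 1 / real (n + 1)"
      \<comment> \<open>The error \<open>q\<close> is paid twice: for the part missed by
        \<open>E n\<close> and for the removed inner sector.\<close>
      have c': "c < 1 - 2 * q"
        using n(1) c by (simp add: q_def field_simps)
      have "0 < r (Suc n)"
        using r_ge[of "Suc n"] by simp
      then have "c * sector_area (r (Suc n)) < (1 - 2 * q) * sector_area (r (Suc n))"
        using c' sector_area_pos by (simp add: mult_strict_right_mono)
      also have "\<dots> = (1 - q) * sector_area (r (Suc n)) - q * sector_area (r (Suc n))"
        by (simp add: algebra_simps)
      also have "\<dots> \<le> measure lebesgue (E n \<inter> truncated_sector \<alpha> (r (Suc n))) - sector_area (r n)"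
        using P[of n] unfolding P_def q_def by linarith
      also have "\<dots> \<le> measure lebesgue (A \<inter> truncated_sector \<alpha> (r (Suc n)))"
      proof -
        have "measure lebesgue (E n \<inter> truncated_sector \<alpha> (r (Suc n)))
            \<le> measure lebesgue ((A \<inter> truncated_sector \<alpha> (r (Suc n))) \<union> truncated_sector \<alpha> (r n))"
          using E A truncated_sector_lmeasurable Int_truncated_sector_lmeasurable[OF A]
          by (intro measure_mono_fmeasurable fmeasurable.Un) (auto simp: A_def)
        also have "\<dots> \<le> measure lebesgue (A \<inter> truncated_sector \<alpha> (r (Suc n))) + sector_area (r n)"
          using A by (intro measure_Un_le) auto
        finally show ?thesis by simp
      qed
      finally show "\<exists>s\<ge>N. c * sector_area s < measure lebesgue (A \<inter> truncated_sector \<alpha> s)"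
        using n(2) by blast
    qed
    fix n
    \<comment> \<open>The radius \<open>r n\<close> works: a point of \<open>A\<close> beyond it can
      only come from an annulus of index at least \<open>n\<close>.\<close>
    have "\<exists>m\<ge>n. t \<in> E m" if t: "t \<in> A" "r n \<le> norm t" for t
    proof -
      obtain m where m: "t \<in> E m" "norm t < r (Suc m)"
        using t(1) by (auto simp: A_def truncated_sector_def)
      then have "r n < r (Suc m)"
        using t(2) by linarith
      then have "n \<le> m"
        using monoD[OF mono, of "Suc m" n] by (meson not_less not_less_eq_eq)
      then show ?thesis
        using m(1) by blast
    qed
    then show "\<exists>R. \<forall>t\<in>A. R \<le> norm t \<longrightarrow> (\<exists>m\<ge>n. t \<in> E m)"
      by blast
  qed
qed

end

section \<open>Superlevel sets of orbit norms\<close>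

locale strongly_continuous_sector_family = planar_sector \<alpha> for \<alpha> :: real +
  fixes T :: "complex \<Rightarrow> 'a::banach \<Rightarrow> 'a"
  assumes operator: "t \<in> sector \<alpha> \<Longrightarrow> bounded_linear (T t)"
    and continuous_orbit: "continuous_on (sector \<alpha>) (\<lambda>t. T t x)"
begin

definition superlevel :: "'a \<Rightarrow> real \<Rightarrow> complex set" where
  "superlevel x M = {t \<in> sector \<alpha>. M < norm (T t x)}"

text \<open>Orbits are continuous only on the sector, so the set is relatively open there: the
  intersection of a closed set with an open one, hence Borel.\<close>

lemma superlevel_sets [measurable]: "superlevel x M \<in> sets lebesgue"
proof -
  have "openin (top_of_set (sector \<alpha>)) (sector \<alpha> \<inter> (\<lambda>t. norm (T t x)) -` {M<..})"
    using continuous_orbit by (intro continuous_openin_preimage_gen continuous_intros) auto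
  moreover have "sector \<alpha> \<inter> (\<lambda>t. norm (T t x)) -` {M<..} = superlevel x M"
    by (auto simp: superlevel_def)
  ultimately obtain U where "open U" "superlevel x M = sector \<alpha> \<inter> U"
    by (auto simp: openin_open)
  then have "superlevel x M \<in> sets borel"
    by simp
  then show ?thesis
    by (simp add: sets_completionI_sets)
qed

text \<open>Removes the existentially quantified set \<open>A\<close>. Up to a bounded part, any
  witness lies in every superlevel set; conversely, the diagonal set of the superlevel sets is a
  witness.\<close>

lemma distributionally_unbounded_iff:
  "distributionally_unbounded \<alpha> T x \<longleftrightarrow> (\<forall>m::nat. full_upper_density \<alpha> (superlevel x (real m)))"
proof
  assume "distributionally_unbounded \<alpha> T x"
  then obtain A where A: "A \<subseteq> sector \<alpha>" "full_upper_density \<alpha> A"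
    and lim: "filterlim (\<lambda>t. norm (T t x)) at_top (inf at_infinity (principal A))"
    unfolding distributionally_unbounded_def upper_density_eq_1_iff by blast
  show "\<forall>m::nat. full_upper_density \<alpha> (superlevel x (real m))"
  proof
    fix m :: nat
    have "\<forall>\<^sub>F t in inf at_infinity (principal A). real m < norm (T t x)"
      using lim by (simp add: filterlim_at_top_dense)
    then obtain R where "\<And>t. R \<le> norm t \<Longrightarrow> t \<in> A \<Longrightarrow> real m < norm (T t x)"
      unfolding eventually_inf_principal eventually_at_infinity by blast
    then have "A \<subseteq> superlevel x (real m) \<union> truncated_sector \<alpha> R"
      using A(1) by (fastforce simp: superlevel_def truncated_sector_def)
    then show "full_upper_density \<alpha> (superlevel x (real m))"
      by (rule full_upper_density_mono[OF A(2) superlevel_sets])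
  qed
next
  assume "\<forall>m::nat. full_upper_density \<alpha> (superlevel x (real m))"
  then obtain A where A: "A \<in> sets lebesgue" "A \<subseteq> sector \<alpha>" "full_upper_density \<alpha> A"
    "\<And>n. \<exists>R. \<forall>t\<in>A. R \<le> norm t \<longrightarrow> (\<exists>m\<ge>n. t \<in> superlevel x (real m))"
    using full_upper_density_diagonal[of "\<lambda>m. superlevel x (real m)"] by auto
  have "filterlim (\<lambda>t. norm (T t x)) at_top (inf at_infinity (principal A))"
    unfolding filterlim_at_top
  proof
    fix Z :: real
    obtain n :: nat where n: "Z \<le> real n"
      using real_arch_simple by blast
    obtain R where R: "\<And>t. t \<in> A \<Longrightarrow> R \<le> norm t \<Longrightarrow> \<exists>m\<ge>n. t \<in> superlevel x (real m)"
      using A(4)[of n] by blast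
    have "Z \<le> norm (T t x)" if t: "t \<in> A" "R \<le> norm t" for t
    proof -
      obtain m where "n \<le> m" "real m < norm (T t x)"
        using R[OF t] by (auto simp: superlevel_def)
      then show ?thesis using n by linarith
    qed
    then show "\<forall>\<^sub>F t in inf at_infinity (principal A). Z \<le> norm (T t x)"
      unfolding eventually_inf_principal eventually_at_infinity by blast
  qed
  then show "distributionally_unbounded \<alpha> T x"
    using A unfolding distributionally_unbounded_def upper_density_eq_1_iff by blast
qed

text \<open>Lower semicontinuity of the area of a superlevel set is Fatou's lemma for the pointwise
  convergence of the orbits.\<close>

lemma open_superlevel_area:
  "open {x. c < measure lebesgue (superlevel x M \<inter> truncated_sector \<alpha> r)}"
proof -
  let ?S = "\<lambda>x. superlevel x M \<inter> truncated_sector \<alpha> r"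
  have "closed {x. measure lebesgue (?S x) \<le> c}"
    unfolding closed_sequential_limits
  proof (intro allI impI, elim conjE)
    fix x l assume x: "\<forall>n::nat. x n \<in> {x. measure lebesgue (?S x) \<le> c}" and lim: "x \<longlonglongrightarrow> l"
    \<comment> \<open>The sets \<open>F n\<close> increase to the set-theoretic liminf of the
      truncated superlevel sets, and each has area at most \<open>c\<close>.\<close>
    define F where "F = (\<lambda>n. \<Inter>m\<in>{n..}. ?S (x m))"
    have F: "F n \<in> sets lebesgue" for n
      unfolding F_def by (intro sets.countable_INT') auto
    have F_sub: "F n \<subseteq> ?S (x n)" for n
      by (auto simp: F_def)
    have F_le: "measure lebesgue (F n) \<le> c" for n
      using measure_mono_fmeasurable[OF F_sub F Int_truncated_sector_lmeasurable, of n] x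
      by (force intro: order_trans)
    have UF: "(\<Union>n. F n) \<in> lmeasurable"
      using F F_sub by (intro fmeasurableI2[OF truncated_sector_lmeasurable[of r]]) auto
    have "incseq F"
      by (force simp: F_def incseq_def)
    then have "(\<lambda>n. measure lebesgue (F n)) \<longlonglongrightarrow> measure lebesgue (\<Union>n. F n)"
      using F UF by (intro Lim_measure_incseq) (auto simp: fmeasurable_def)
    then have UF_le: "measure lebesgue (\<Union>n. F n) \<le> c"
      using F_le by (intro LIMSEQ_le_const2) auto
    \<comment> \<open>The inequality defining a superlevel set is strict, so at each point it passes
      from the limit to all late members of the sequence.\<close>
    have "?S l \<subseteq> (\<Union>n. F n)"
    proof
      fix t assume t: "t \<in> ?S l"
      then have "t \<in> sector \<alpha>" "M < norm (T t l)"
        by (auto simp: superlevel_def)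
      then have "(\<lambda>n. norm (T t (x n))) \<longlonglongrightarrow> norm (T t l)"
        by (intro tendsto_norm bounded_linear.tendsto[OF operator lim])
      then have "\<forall>\<^sub>F n in sequentially. M < norm (T t (x n))"
        using \<open>M < norm (T t l)\<close> by (rule order_tendstoD)
      then show "t \<in> (\<Union>n. F n)"
        using t by (auto simp: F_def superlevel_def eventually_sequentially)
    qed
    then have "measure lebesgue (?S l) \<le> measure lebesgue (\<Union>n. F n)"
      using UF by (intro measure_mono_fmeasurable) auto
    then show "l \<in> {x. measure lebesgue (?S x) \<le> c}"
      using UF_le by simp
  qed
  then have "open (- {x. measure lebesgue (?S x) \<le> c})"
    by blast
  then show ?thesis
    by (simp add: Collect_neg_eq[symmetric] not_le)
qed

section \<open>The distributionally unbounded vectors as a countable intersection of open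
  sets\<close>

text \<open>Integer parameters replace the real threshold, the level \<open>c\<close> and the lower
  bound for the radius, so that countably many sets suffice. The union over uncountably many radii
  is harmless for openness.\<close>

definition nearly_full :: "nat \<Rightarrow> nat \<Rightarrow> nat \<Rightarrow> 'a set" where
  "nearly_full m k N = (\<Union>r\<in>{real N..}. {x. (1 - 1 / real (Suc k)) * sector_area r
     < measure lebesgue (superlevel x (real m) \<inter> truncated_sector \<alpha> r)})"

lemma open_nearly_full: "open (nearly_full m k N)"
  unfolding nearly_full_def by (rule open_UN, rule ballI, rule open_superlevel_area)

lemma DUnbd_eq: "DUnbd \<alpha> T = (\<Inter>(m, k, N)\<in>UNIV. nearly_full m k N)"
proof (intro equalityI subsetI)
  fix x assume "x \<in> DUnbd \<alpha> T"
  then have full: "full_upper_density \<alpha> (superlevel x (real m))" for m :: nat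
    by (simp add: DUnbd_def distributionally_unbounded_iff)
  have "x \<in> nearly_full m k N" for m k N
  proof -
    have "1 - 1 / real (Suc k) < 1"
      by simp
    then obtain r where "real N \<le> r" "(1 - 1 / real (Suc k)) * sector_area r
       < measure lebesgue (superlevel x (real m) \<inter> truncated_sector \<alpha> r)"
      using full[of m] unfolding full_upper_density_def by blast
    then show ?thesis
      unfolding nearly_full_def by auto
  qed
  then show "x \<in> (\<Inter>(m, k, N)\<in>UNIV. nearly_full m k N)"
    by auto
next
  fix x assume "x \<in> (\<Inter>(m, k, N)\<in>UNIV. nearly_full m k N)"
  then have x: "x \<in> nearly_full m k N" for m k N
    by auto
  have "full_upper_density \<alpha> (superlevel x (real m))" for m :: nat
    unfolding full_upper_density_def
  proof (intro allI impI)
    fix c N :: real assume "c < 1"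
    \<comment> \<open>The levels 1 - 1 / \<open>real (Suc k)\<close> are cofinal below 1.\<close>
    then obtain k where k: "1 / real (Suc k) < 1 - c"
      using nat_approx_posE[of "1 - c"] by auto
    obtain N' :: nat where N': "N \<le> real N'"
      using real_arch_simple by blast
    obtain r where r: "real N' \<le> r" "(1 - 1 / real (Suc k)) * sector_area r
       < measure lebesgue (superlevel x (real m) \<inter> truncated_sector \<alpha> r)"
      using x[of m k N'] unfolding nearly_full_def by auto
    have "c * sector_area r \<le> (1 - 1 / real (Suc k)) * sector_area r"
      using k by (intro mult_right_mono) auto
    then show "\<exists>r\<ge>N. c * sector_area r < measure lebesgue (superlevel x (real m) \<inter> truncated_sector \<alpha> r)"
      using r N' by (intro exI[of _ r]) auto
  qed
  then show "x \<in> DUnbd \<alpha> T"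
    by (simp add: DUnbd_def distributionally_unbounded_iff)
qed

lemma gdelta_in_DUnbd: "gdelta_in euclidean (DUnbd \<alpha> T)"
proof -
  have "gdelta_in euclidean (nearly_full m k N)" for m k N
    using open_nearly_full by (intro open_imp_gdelta_in) simp
  then show ?thesis
    unfolding DUnbd_eq by (intro gdelta_in_Inter) auto
qed

section \<open>Sensitivity and scaling\<close>

lemma superlevel_scaleR:
  assumes "0 < c"
  shows "superlevel (c *\<^sub>R x) (c * M) = superlevel x M"
proof -
  have "T t (c *\<^sub>R x) = c *\<^sub>R T t x" if "t \<in> sector \<alpha>" for t
    using operator[OF that] by (intro linear_scale bounded_linear.linear)
  then show ?thesis
    using assms by (auto simp: superlevel_def)
qed

text \<open>By linearity only the difference \<open>z\<close> = \<open>x - y\<close> matters, so the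
  base point disappears.\<close>

lemma distributionally_sensitive_iff:
  "distributionally_sensitive \<alpha> T \<longleftrightarrow>
     (\<exists>\<delta>>0. \<forall>\<epsilon>>0. \<exists>z. norm z < \<epsilon> \<and> full_upper_density \<alpha> (superlevel z \<delta>))"
proof -
  have "T t (x - y) = T t x - T t y" if "t \<in> sector \<alpha>" for t x y
    using operator[OF that] by (intro linear_diff bounded_linear.linear)
  then have "{t \<in> sector \<alpha>. norm (T t x - T t y) > \<delta>} = superlevel (x - y) \<delta>" for x y \<delta>
    by (auto simp: superlevel_def)
  moreover have "\<exists>y. z = x - y" for x z :: 'a
    by (rule exI[of _ "x - z"]) simp
  then have "(\<exists>y. norm (x - y) < \<epsilon> \<and> full_upper_density \<alpha> (superlevel (x - y) \<delta>)) \<longleftrightarrow>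
     (\<exists>z. norm z < \<epsilon> \<and> full_upper_density \<alpha> (superlevel z \<delta>))" for x \<epsilon> \<delta>
    by metis
  ultimately show ?thesis
    unfolding distributionally_sensitive_def upper_density_eq_1_iff by simp
qed

text \<open>Dividing one unbounded vector by a large \<open>m\<close> makes it small, while its
  superlevel set at \<open>m\<close> becomes the one at 1; hence \<delta> = 1 works.\<close>

lemma distributionally_sensitiveI:
  assumes "distributionally_unbounded \<alpha> T x"
  shows "distributionally_sensitive \<alpha> T"
  unfolding distributionally_sensitive_iff
proof (intro exI[of _ 1] conjI allI impI)
  fix \<epsilon> :: real assume "0 < \<epsilon>"
  obtain m :: nat where m: "norm x / \<epsilon> < real m"
    using reals_Archimedean2 by blast
  then have "0 < real m"
    using \<open>0 < \<epsilon>\<close> by (meson divide_nonneg_pos norm_ge_zero order_le_less_trans)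
  moreover have "full_upper_density \<alpha> (superlevel x (real m))"
    using assms distributionally_unbounded_iff by blast
  ultimately have "full_upper_density \<alpha> (superlevel ((1 / real m) *\<^sub>R x) 1)"
    using superlevel_scaleR[of "1 / real m" x "real m"] by simp
  moreover have "norm ((1 / real m) *\<^sub>R x) < \<epsilon>"
    using m \<open>0 < \<epsilon>\<close> \<open>0 < real m\<close> by (simp add: field_simps)
  ultimately show "\<exists>z. norm z < \<epsilon> \<and> full_upper_density \<alpha> (superlevel z 1)"
    by blast
qed simp

text \<open>The fixed sensitivity constant can be traded for any threshold \<open>M\<close>: choose
  the vector smaller by the factor \<delta> / \<open>M\<close>, then multiply it by \<open>M\<close>
  / \<delta>.\<close>

lemma distributionally_sensitiveD:
  assumes "distributionally_sensitive \<alpha> T" "0 < \<epsilon>" "0 < M"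
  obtains z where "norm z < \<epsilon>" "full_upper_density \<alpha> (superlevel z M)"
proof -
  obtain \<delta> where \<delta>: "0 < \<delta>"
    "\<forall>\<epsilon>>0. \<exists>z. norm z < \<epsilon> \<and> full_upper_density \<alpha> (superlevel z \<delta>)"
    using assms(1) unfolding distributionally_sensitive_iff by (elim exE conjE)
  have "0 < \<epsilon> * \<delta> / M"
    using \<delta>(1) assms(2,3) by simp
  then obtain z where z: "norm z < \<epsilon> * \<delta> / M" "full_upper_density \<alpha> (superlevel z \<delta>)"
    using \<delta>(2) by meson
  show thesis
  proof
    show "norm ((M / \<delta>) *\<^sub>R z) < \<epsilon>"
      using z(1) \<delta>(1) assms(3) by (simp add: field_simps)
    show "full_upper_density \<alpha> (superlevel ((M / \<delta>) *\<^sub>R z) M)"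
      using z(2) superlevel_scaleR[of "M / \<delta>" z \<delta>] \<delta>(1) assms(3) by simp
  qed
qed

section \<open>Density by averaging and Baire's theorem\<close>

text \<open>The two error terms are the average area of \<open>n\<close> disjoint exceptional sets
  and the area where the orbit of \<open>z\<close> is not large.\<close>

lemma exists_translate_superlevel:
  assumes "0 < n" "0 \<le> M"
  shows "\<exists>i<n. sector_area r \<le> measure lebesgue (superlevel (x + real i *\<^sub>R z) M \<inter> truncated_sector \<alpha> r)
    + sector_area r / real n + (sector_area r - measure lebesgue (superlevel z (2 * M) \<inter> truncated_sector \<alpha> r))"
proof -
  let ?D = "truncated_sector \<alpha> r"
  define Z where "Z = superlevel z (2 * M) \<inter> ?D"
  define G where "G = (\<lambda>i::nat. superlevel (x + real i *\<^sub>R z) M \<inter> ?D)"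
  define B where "B = (\<lambda>i. Z - G i)"
  have lm: "?D \<in> lmeasurable" "Z \<in> lmeasurable" "G i \<in> lmeasurable" "B i \<in> lmeasurable" for i
    unfolding B_def Z_def G_def
    by (intro fmeasurable.Diff Int_truncated_sector_lmeasurable truncated_sector_lmeasurable superlevel_sets)+
  \<comment> \<open>At a common point of \<open>B i\<close> and \<open>B j\<close> the difference of
    the two translates has image of norm at most 2 * \<open>M\<close>, yet that image is a nonzero
    integer multiple of \<open>T t z\<close>, whose norm exceeds 2 * \<open>M\<close>.\<close>
  have disj: "disjoint_family_on B {..<n}"
    unfolding disjoint_family_on_def
  proof (intro ballI impI, rule ccontr)
    fix i j assume "i \<noteq> j" "B i \<inter> B j \<noteq> {}"
    then obtain t where t: "t \<in> Z" "t \<notin> G i" "t \<notin> G j"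
      by (auto simp: B_def)
    then have ts: "t \<in> sector \<alpha>" "2 * M < norm (T t z)"
      and le: "norm (T t (x + real i *\<^sub>R z)) \<le> M" "norm (T t (x + real j *\<^sub>R z)) \<le> M"
      by (auto simp: Z_def G_def superlevel_def)
    have "linear (T t)"
      using operator[OF ts(1)] by (rule bounded_linear.linear)
    then have "T t (x + real i *\<^sub>R z) - T t (x + real j *\<^sub>R z) = (real i - real j) *\<^sub>R T t z"
      by (simp add: linear_add linear_scale scaleR_diff_left)
    then have "\<bar>real i - real j\<bar> * norm (T t z) \<le> 2 * M"
      using le by (metis norm_scaleR norm_triangle_le_diff add_mono mult_2)
    moreover have "1 \<le> \<bar>real i - real j\<bar>"
      using \<open>i \<noteq> j\<close> by linarith
    then have "1 * norm (T t z) \<le> \<bar>real i - real j\<bar> * norm (T t z)"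
      by (intro mult_right_mono) auto
    ultimately show False
      using ts(2) by linarith
  qed
  have "\<exists>i<n. measure lebesgue (B i) \<le> sector_area r / real n"
  proof (rule ccontr)
    assume "\<not> ?thesis"
    then have "(\<Sum>i<n. sector_area r / real n) < (\<Sum>i<n. measure lebesgue (B i))"
      using assms(1) by (intro sum_strict_mono) auto
    also have "\<dots> = measure lebesgue (\<Union>i<n. B i)"
      using disj lm(4) by (intro measure_UNION'[symmetric]) (auto simp: disjoint_family_on_def pairwise_def disjnt_def)
    also have "\<dots> \<le> sector_area r"
    proof (intro measure_mono_fmeasurable)
      show "(\<Union>i<n. B i) \<in> sets lebesgue"
        using lm(4) by (intro sets.finite_UN) (auto dest: fmeasurableD)
    qed (use lm(1) in \<open>auto simp: B_def Z_def\<close>)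
    finally show False
      using assms(1) by simp
  qed
  then obtain i where i: "i < n" "measure lebesgue (B i) \<le> sector_area r / real n"
    by blast
  \<comment> \<open>The truncated sector is covered by the good set, the exceptional set inside
    \<open>Z\<close>, and the complement of \<open>Z\<close>.\<close>
  have "sector_area r \<le> measure lebesgue ((G i \<union> B i) \<union> (?D - Z))"
    using lm by (intro measure_mono_fmeasurable) (auto simp: B_def)
  also have "\<dots> \<le> measure lebesgue (G i) + measure lebesgue (B i) + measure lebesgue (?D - Z)"
    using lm measure_Un_le[of "G i \<union> B i" lebesgue "?D - Z"] measure_Un_le[of "G i" lebesgue "B i"]
    by (force simp: fmeasurableD)
  also have "measure lebesgue (?D - Z) = sector_area r - measure lebesgue Z"
    using lm by (intro measurable_measure_Diff) (auto simp: Z_def fmeasurableD)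
  finally show ?thesis
    using i unfolding G_def Z_def by (intro exI[of _ i]) auto
qed

lemma closure_nearly_full:
  assumes "distributionally_sensitive \<alpha> T"
  shows "closure (nearly_full m k N) = UNIV"
proof -
  have "\<exists>y\<in>nearly_full m k N. dist y x < \<epsilon>" if \<epsilon>: "0 < \<epsilon>" for x \<epsilon>
  proof -
    \<comment> \<open>Two errors of relative size 1 / \<open>n\<close> add up to the permitted 1 /
      \<open>real (Suc k)\<close>.\<close>
    define n where "n = 2 * Suc k"
    have n: "0 < n" by (simp add: n_def)
    \<comment> \<open>The bound \<epsilon> / \<open>n\<close> keeps every translate with
      \<open>i\<close> < \<open>n\<close> within \<epsilon> of \<open>x\<close>. The extra 1 makes
      the threshold positive even for \<open>m\<close> = 0.\<close>
    obtain z where z: "norm z < \<epsilon> / real n" "full_upper_density \<alpha> (superlevel z (2 * real m + 1))"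
      using distributionally_sensitiveD[OF assms, of "\<epsilon> / real n" "2 * real m + 1"] \<epsilon> n by auto
    have "full_upper_density \<alpha> (superlevel z (2 * real m))"
      \<comment> \<open>For \<open>R\<close> = 0 the discarded sector is empty, so this is plain
        monotonicity.\<close>
      by (rule full_upper_density_mono[OF z(2) superlevel_sets, where R = 0]) (auto simp: superlevel_def)
    moreover have "1 - 1 / real n < 1"
      using n by simp
    ultimately obtain r where r: "real N \<le> r"
      "(1 - 1 / real n) * sector_area r < measure lebesgue (superlevel z (2 * real m) \<inter> truncated_sector \<alpha> r)"
      unfolding full_upper_density_def by blast
    obtain i where i: "i < n" "sector_area r \<le>
      measure lebesgue (superlevel (x + real i *\<^sub>R z) (real m) \<inter> truncated_sector \<alpha> r)
      + sector_area r / real n + (sector_area r - measure lebesgue (superlevel z (2 * real m) \<inter> truncated_sector \<alpha> r))"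
      using exists_translate_superlevel[OF n, of "real m" r x z] by auto
    have "1 / real (Suc k) = 1 / real n + 1 / real n"
      by (simp add: n_def field_simps)
    then have "(1 - 1 / real (Suc k)) * sector_area r = (1 - 1 / real n) * sector_area r - sector_area r / real n"
      by (simp only:) (simp add: algebra_simps)
    then have "(1 - 1 / real (Suc k)) * sector_area r
        < measure lebesgue (superlevel (x + real i *\<^sub>R z) (real m) \<inter> truncated_sector \<alpha> r)"
      using r(2) i(2) by linarith
    then have "x + real i *\<^sub>R z \<in> nearly_full m k N"
      using r(1) by (auto simp: nearly_full_def)
    moreover have "dist (x + real i *\<^sub>R z) x < \<epsilon>"
    proof -
      have "real i * norm z \<le> real n * norm z"
        using i(1) by (intro mult_right_mono) auto
      also have "\<dots> < \<epsilon>"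
        using z(1) n by (simp add: field_simps)
      finally show ?thesis
        by (simp add: dist_norm)
    qed
    ultimately show ?thesis
      by blast
  qed
  then show ?thesis
    by (auto simp: closure_approachable)
qed

lemma closure_DUnbd:
  assumes "distributionally_sensitive \<alpha> T"
  shows "closure (DUnbd \<alpha> T) = UNIV"
proof -
  have "Metric_space.mcomplete (UNIV :: 'a set) dist"
    by (simp add: complete_UNIV)
  then have "Met_TC.mtopology closure_of \<Inter>(range (\<lambda>(m, k, N). nearly_full m k N)) = UNIV"
    by (rule Met_TC.metric_Baire_category)
       (auto simp: closure_nearly_full[OF assms] open_nearly_full)
  then show ?thesis
    by (simp add: DUnbd_eq)
qed

end

theorem proposition3p6:
  fixes T :: "complex \<Rightarrow> 'a::banach \<Rightarrow> 'a" and \<alpha> :: real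
  assumes "0 < \<alpha>" and "\<alpha> < pi / 2"
    and "C0_semigroup \<alpha> T"
  shows "(distributionally_sensitive \<alpha> T \<longleftrightarrow> (\<exists>x. distributionally_unbounded \<alpha> T x)) \<and>
    ((\<exists>x. distributionally_unbounded \<alpha> T x) \<longleftrightarrow>
       gdelta_in euclidean (DUnbd \<alpha> T) \<and> closure (DUnbd \<alpha> T) = UNIV)"
proof -
  interpret strongly_continuous_sector_family \<alpha> T
  proof (intro strongly_continuous_sector_family.intro planar_sector.intro
      strongly_continuous_sector_family_axioms.intro)
    show "0 < \<alpha>" "\<alpha> < pi"
      using assms(1,2) by auto
    show "bounded_linear (T t)" if "t \<in> sector \<alpha>" for t
      using assms(3) that by (simp add: C0_semigroup_def)
    show "continuous_on (sector \<alpha>) (\<lambda>t. T t x)" for x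
      using assms(3) by (simp add: C0_semigroup_def continuous_on_def)
  qed
  \<comment> \<open>A dense set is nonempty. This closes the cycle from sensitivity through density
    to an unbounded vector and back to sensitivity.\<close>
  have "\<exists>x. distributionally_unbounded \<alpha> T x" if "closure (DUnbd \<alpha> T) = UNIV"
  proof -
    have "DUnbd \<alpha> T \<noteq> {}"
      using that by auto
    then show ?thesis
      by (auto simp: DUnbd_def)
  qed
  then show ?thesis
    using distributionally_sensitiveI closure_DUnbd gdelta_in_DUnbd by blast
qed

end
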